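(* In the setting described in the context (polyhedral feasible set $\mathcal D_P$, $f$ continuously differentiable and $L$-relatively smooth with respect to the Shannon entropy on $\mathcal D_P$, and $\{x^k\}_{k\ge 0}$ a BPGM sequence with $x^0\in\mathcal D_P\cap\mathbb R^n_{++}$ and step sizes $\alpha_k\in[\underline\alpha,\bar\alpha]$, $0<\underline\alpha<\bar\alpha<1/L$), suppose further that $F=f+\delta_{\mathcal D_P}$ is an SKŁ function and that the sequence $\{x^k\}_{k\ge0}$ is bounded. Then $\{x^k\}_{k\ge 0}$ converges to a critical point of $F$.
   Context: Setting. $A\in\mathbb R^{m\times n}$ has full row rank, $b\in\mathbb R^m$, $\mathcal D_P=\{x\in\mathbb R^n: Ax=b,\ x\ge 0\}$, and $\mathcal D_P\cap\mathbb R^n_{++}\neq\emptyset$. $h_S(x)=\sum_{i=1}^n x_i\log x_i$ on $\mathbb R^n_+$ (with $0\log 0=0$). The function $f:\mathbb R^n\to\mathbb R$ is continuously differentiable (not necessarily convex) and $L$-relatively smooth with respect to $h_S$ on $\mathcal D_P$ for some $L>0$, i.e. $Lh_S-f$ is convex on $\mathcal D_P$. The problem $\min_{x\in\mathcal D_P} f(x)$ is assumed to have an optimal solution. $F=f+\delta_{\mathcal D_P}$, where $\delta_{\mathcal D_P}$ is $0$ on $\mathcal D_P$ and $+\infty$ elsewhere. BPGM. For $x\in\mathbb R^n_+$, $y\in\mathbb R^n_{++}$, $D_{h_S}(x,y)=h_S(x)-h_S(y)-\nabla h_S(y)^\top(x-y)$. A BPGM sequence starts at $x^0\in\mathcal D_P\cap\mathbb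 R^n_{++}$ and satisfies, for $k\ge0$, $x^{k+1}=\operatorname{argmin}_{x\in\mathcal D_P}\{f(x^k)+\nabla f(x^k)^\top(x-x^k)+\frac1{\alpha_k}D_{h_S}(x,x^k)\}$. Equivalently, with $\exp$ entrywise, $x^{k+1}=\operatorname{Diag}(\exp(-\alpha_k(\nabla f(x^k)+A^\top\mu^k)))x^k\in\mathcal D_P\cap\mathbb R^n_{++}$, where $\mu^k=\operatorname{argmin}_{\mu\in\mathbb R^m}\{\frac1{\alpha_k}\exp(-\alpha_k(\nabla f(x^k)+A^\top\mu))^\top x^k+b^\top\mu\}$. Subdifferential. For proper $g:\mathbb R^n\to\mathbb R\cup\{+\infty\}$ and $x\in\operatorname{dom}(g)$, $\widehat\partial g(x)$ is the set of $v$ with $\liminf_{y\to x,\,y\ne x}\frac{g(y)-g(x)-\langle v,y-x\rangle}{\|y-x\|_2}\ge0$, and $\partial g(x)$ is the set of limits of $v^k\in\widehat\partial g(x^k)$ with $x^k\to x$, $g(x^k)\to g(x)$. A function defined on $\mathbb R^n_+$ is extended by $+\infty$ outside. $\operatorname{dom}(\partial g)=\{x:\partial g(x)\ne\emptyset\}$. For $x\in\mathcal D_P$, $\partial F(x)=\{\nabla f(x)+A^\top\mu-\lambda:\mu\in\mathbb R^m,\ \lambda\ge0,\ \lambda^\top x=0\}$. A critical point of $F$ is a point $\bar x$ with $0\in\partial F(\bar x)$. SKŁ property. A function $H:\mathbb R^n_+\to\mathbb R\cup\{+\infty\}$ has the SKŁ property at $x^*\in\operatorname{dom}(\partial H)$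 if there exist $\eta\in(0,+\infty]$, a neighborhood $\mathcal U$ of $x^*$, and a continuous concave $\varphi:[0,\eta)\to\mathbb R_+$ with $\varphi(0)=0$, continuously differentiable on $(0,\eta)$ with $\varphi'>0$ there, such that for all $x\in\mathcal U$ with $H(x^* )<H(x)<H(x^* )+\eta$: $\varphi'(H(x)-H(x^* ))\cdot\operatorname{dist}(0,\operatorname{Diag}(\sqrt x)\,\partial H(x))\ge1$. Here $\sqrt x$ is entrywise, $\operatorname{dist}$ is Euclidean, and $\operatorname{dist}(0,\emptyset)=+\infty$. $H$ is an SKŁ function if it has the SKŁ property at every $x^*\in\operatorname{dom}(\partial H)$. $F$ is regarded as a function on $\mathbb R^n_+$ by restriction. *)

theory Defs
  imports "HOL-Analysis.Analysis"
begin

definition gradient :: "('a::real_inner \<Rightarrow> real) \<Rightarrow> 'a \<Rightarrow> 'a" where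
  "gradient f x = (THE g. GDERIV f x :> g)"

definition continuously_differentiable :: "('a::real_inner \<Rightarrow> real) \<Rightarrow> bool" where
  "continuously_differentiable f \<longleftrightarrow>
     f differentiable_on UNIV \<and> continuous_on UNIV (gradient f)"

definition nonneg_orthant :: "(real ^ 'n) set" where
  "nonneg_orthant = {x. \<forall>i. 0 \<le> x $ i}"

definition pos_orthant :: "(real ^ 'n) set" where
  "pos_orthant = {x. \<forall>i. 0 < x $ i}"

definition polyhedron_eq :: "real ^ 'n ^ 'm \<Rightarrow> real ^ 'm \<Rightarrow> (real ^ 'n) set" where
  "polyhedron_eq A b = {x. A *v x = b \<and> x \<in> nonneg_orthant}"

text \<open>Only the values on the nonnegative orthant are meaningful; there the summand
  vanishes at \<open>x $ i = 0\<close>.\<close>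

definition shannon_entropy :: "real ^ 'n \<Rightarrow> real" where
  "shannon_entropy x = (\<Sum>i\<in>UNIV. x $ i * ln (x $ i))"

definition bregman_distance :: "('a::real_inner \<Rightarrow> real) \<Rightarrow> 'a \<Rightarrow> 'a \<Rightarrow> real" where
  "bregman_distance h x y = h x - h y - gradient h y \<bullet> (x - y)"

definition relatively_smooth_on ::
    "('a::real_vector) set \<Rightarrow> ('a \<Rightarrow> real) \<Rightarrow> real \<Rightarrow> ('a \<Rightarrow> real) \<Rightarrow> bool" where
  "relatively_smooth_on S h L f \<longleftrightarrow> convex_on S (\<lambda>x. L * h x - f x)"

text \<open>The Bregman distance is only meaningful for a positive second argument. This holds
  at every iterate as soon as \<open>S\<close> is a polyhedron as above and \<open>x 0\<close> is positive, because
  the entropy forces the minimizers into the positive orthant.\<close>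

definition bpgm_sequence ::
    "(real ^ 'n \<Rightarrow> real) \<Rightarrow> (real ^ 'n) set \<Rightarrow> (nat \<Rightarrow> real) \<Rightarrow> (nat \<Rightarrow> real ^ 'n) \<Rightarrow> bool" where
  "bpgm_sequence f S \<alpha> x \<longleftrightarrow>
     x 0 \<in> S \<inter> pos_orthant \<and>
     (\<forall>k. is_arg_min
        (\<lambda>y. f (x k) + gradient f (x k) \<bullet> (y - x k)
              + 1 / \<alpha> k * bregman_distance shannon_entropy y (x k))
        (\<lambda>y. y \<in> S) (x (Suc k)))"

text \<open>Functions into the reals with \<open>+\<infinity>\<close> are modelled with values in \<open>ereal\<close>.\<close>

definition indicator_ereal :: "'a set \<Rightarrow> 'a \<Rightarrow> ereal" where
  "indicator_ereal S x = (if x \<in> S then 0 else \<infinity>)"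

definition effective_domain :: "('a \<Rightarrow> ereal) \<Rightarrow> 'a set" where
  "effective_domain g = {x. \<bar>g x\<bar> \<noteq> \<infinity>}"

definition frechet_subdiff :: "('a::real_inner \<Rightarrow> ereal) \<Rightarrow> 'a \<Rightarrow> 'a set" where
  "frechet_subdiff g x = {v. x \<in> effective_domain g \<and>
     0 \<le> Liminf (at x) (\<lambda>y. (g y - g x - ereal (v \<bullet> (y - x))) / ereal (norm (y - x)))}"

definition limiting_subdiff :: "('a::real_inner \<Rightarrow> ereal) \<Rightarrow> 'a \<Rightarrow> 'a set" where
  "limiting_subdiff g x = {v. x \<in> effective_domain g \<and>
     (\<exists>xs vs. xs \<longlonglongrightarrow> x \<and> (\<lambda>k. g (xs k)) \<longlonglongrightarrow> g x \<and>
        (\<forall>k. vs k \<in> frechet_subdiff g (xs k)) \<and> vs \<longlonglongrightarrow> v)}"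

definition critical_point :: "('a::real_inner \<Rightarrow> ereal) \<Rightarrow> 'a \<Rightarrow> bool" where
  "critical_point g x \<longleftrightarrow> 0 \<in> limiting_subdiff g x"

text \<open>A function on the nonnegative orthant is represented by any function on the whole
  space; its values elsewhere are overridden by \<open>+\<infinity>\<close> before subdifferentials are taken.\<close>

definition extend_orthant :: "(real ^ 'n \<Rightarrow> ereal) \<Rightarrow> real ^ 'n \<Rightarrow> ereal" where
  "extend_orthant H x = (if x \<in> nonneg_orthant then H x else \<infinity>)"

definition orthant_subdiff :: "(real ^ 'n \<Rightarrow> ereal) \<Rightarrow> real ^ 'n \<Rightarrow> (real ^ 'n) set" where
  "orthant_subdiff H = limiting_subdiff (extend_orthant H)"

definition diag_sqrt :: "real ^ 'n \<Rightarrow> real ^ 'n \<Rightarrow> real ^ 'n" where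
  "diag_sqrt x v = (\<chi> i. sqrt (x $ i) * v $ i)"

text \<open>The infimum in \<open>ereal\<close> gives distance \<open>\<infinity>\<close> to the empty set, unlike \<open>infdist\<close>.\<close>

definition dist_zero :: "('a::real_normed_vector) set \<Rightarrow> ereal" where
  "dist_zero S = (INF v\<in>S. ereal (norm v))"

definition desingularizing :: "ereal \<Rightarrow> (real \<Rightarrow> real) \<Rightarrow> (real \<Rightarrow> real) \<Rightarrow> bool" where
  "desingularizing \<eta> \<phi> \<phi>' \<longleftrightarrow>
     continuous_on {t. 0 \<le> t \<and> ereal t < \<eta>} \<phi> \<and>
     concave_on {t. 0 \<le> t \<and> ereal t < \<eta>} \<phi> \<and>
     (\<forall>t. 0 \<le> t \<and> ereal t < \<eta> \<longrightarrow> 0 \<le> \<phi> t) \<and>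
     \<phi> 0 = 0 \<and>
     (\<forall>t. 0 < t \<and> ereal t < \<eta> \<longrightarrow> (\<phi> has_real_derivative \<phi>' t) (at t) \<and> 0 < \<phi>' t) \<and>
     continuous_on {t. 0 < t \<and> ereal t < \<eta>} \<phi>'"

definition SKL_property_at :: "(real ^ 'n \<Rightarrow> ereal) \<Rightarrow> real ^ 'n \<Rightarrow> bool" where
  "SKL_property_at H z \<longleftrightarrow>
     (\<exists>\<eta> U \<phi> \<phi>'. 0 < \<eta> \<and> open U \<and> z \<in> U \<and> desingularizing \<eta> \<phi> \<phi>' \<and>
        (\<forall>x \<in> U \<inter> nonneg_orthant. H z < H x \<and> H x < H z + \<eta> \<longrightarrow>
           1 \<le> ereal (\<phi>' (real_of_ereal (H x - H z)))
                 * dist_zero (diag_sqrt x ` orthant_subdiff H x)))"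

definition SKL_function :: "(real ^ 'n \<Rightarrow> ereal) \<Rightarrow> bool" where
  "SKL_function H \<longleftrightarrow> (\<forall>z. orthant_subdiff H z \<noteq> {} \<longrightarrow> SKL_property_at H z)"

end

(* With p k = ln (x (Suc k)) - ln (x k), optimality says that \<alpha> k \<nabla>f(x k) + p k lies in
   V = (ker A)^\<perp>. The p k are bounded: a limit direction u of an unbounded subsequence would lie
   in V and have the signs of x (Suc k) - x k on its support, although x (Suc k) - x k is in ker A.
   Hence, with s k = |Diag(sqrt (x k)) p k|, the decrease of f is at least c (s k)^2, the step length
   is at most C s k, and -p k / \<alpha> k is a subgradient of F at x k, so that the SKL inequality makes
   the step lengths summable. The limit is critical because the sums of the p k telescope. *)
theory Submission
  imports Defs
begin

section \<open>Gradients, Frechet subgradients and tangents of convex functions\<close>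

lemma GDERIV_gradient_eq:
  assumes "GDERIV f x :> g"
  shows "gradient f x = g"
  unfolding gradient_def
proof (rule the_equality, fact assms)
  fix g' assume "GDERIV f x :> g'"
  then have "(\<lambda>h. h \<bullet> g') = (\<lambda>h. h \<bullet> g)"
    using assms by (auto simp: gderiv_def intro: has_derivative_unique)
  then have "(g' - g) \<bullet> (g' - g) = 0"
    by (metis inner_diff_right right_minus_eq)
  then show "g' = g" by simp
qed

lemma GDERIV_gradient:
  fixes f :: "'a::euclidean_space \<Rightarrow> real"
  assumes "f differentiable at x"
  shows "GDERIV f x :> gradient f x"
proof -
  obtain f' where f': "(f has_derivative f') (at x)"
    using assms by (auto simp: differentiable_def)
  \<comment> \<open>Riesz representation: the adjoint of the functional \<open>f'\<close> sends 1 to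
    the vector representing it.\<close>
  have "h \<bullet> adjoint f' 1 = f' h" for h
    using adjoint_works[OF has_derivative_linear[OF f'], of h 1] by simp
  then have "f' = (\<lambda>h. h \<bullet> adjoint f' 1)" by auto
  then have "GDERIV f x :> adjoint f' 1"
    using f' by (simp add: gderiv_def)
  then show ?thesis using GDERIV_gradient_eq by metis
qed

lemma GDERIV_shannon_entropy:
  assumes "x \<in> pos_orthant"
  shows "GDERIV shannon_entropy x :> (\<chi> i. ln (x $ i) + 1)"
proof -
  have pos: "x $ i > 0" for i using assms by (simp add: pos_orthant_def)
  have "((\<lambda>x. x $ i * ln (x $ i)) has_derivative (\<lambda>h. h $ i * (ln (x $ i) + 1))) (at x)" for i
  proof -
    have "((\<lambda>x. x $ i) has_derivative (\<lambda>h. h $ i)) (at x)"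
      by (rule bounded_linear_imp_has_derivative[OF bounded_linear_vec_nth])
    moreover have "((\<lambda>s. s * ln s) has_derivative (\<lambda>s. s * (ln (x $ i) + 1))) (at (x $ i))"
      using pos[of i] by (auto intro!: derivative_eq_intros simp: field_simps fun_eq_iff)
    ultimately show ?thesis
      by (rule has_derivative_compose)
  qed
  from has_derivative_sum[OF this, where I = UNIV] show ?thesis
    by (simp add: gderiv_def shannon_entropy_def[abs_def] inner_vec_def)
qed

text \<open>\<open>v - g\<close> is normal to \<open>D\<close> at \<open>x\<close>. On
  \<open>D\<close> this bounds the quotient below by minus the normalised first-order remainder,
  which tends to 0; off \<open>D\<close> the quotient is \<infinity>.\<close>

lemma frechet_subdiff_constrained:
  fixes f :: "'a::euclidean_space \<Rightarrow> real"
  assumes x: "x \<in> D" and g: "GDERIV f x :> g"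
    and v: "\<And>y. y \<in> D \<Longrightarrow> v \<bullet> (y - x) \<le> g \<bullet> (y - x)"
  shows "v \<in> frechet_subdiff (\<lambda>y. ereal (f y) + indicator_ereal D y) x"
proof -
  let ?F = "\<lambda>y. ereal (f y) + indicator_ereal D y"
  let ?q = "\<lambda>y. - (norm (f y - f x - (y - x) \<bullet> g) / norm (y - x))"
  have "((\<lambda>y. norm (f y - f x - (y - x) \<bullet> g) / norm (y - x)) \<longlongrightarrow> 0) (at x)"
    using g by (simp add: gderiv_def has_derivative_iff_norm)
  from tendsto_minus[OF this] have "((\<lambda>y. ereal (?q y)) \<longlongrightarrow> ereal 0) (at x)"
    by (subst tendsto_ereal) auto
  then have "Liminf (at x) (\<lambda>y. ereal (?q y)) = 0"
    by (simp add: lim_imp_Liminf zero_ereal_def)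
  moreover have "Liminf (at x) (\<lambda>y. ereal (?q y))
      \<le> Liminf (at x) (\<lambda>y. (?F y - ?F x - ereal (v \<bullet> (y - x))) / ereal (norm (y - x)))"
  proof (rule Liminf_mono, unfold eventually_at_filter, intro always_eventually allI impI)
    fix y assume y: "y \<noteq> x"
    show "ereal (?q y) \<le> (?F y - ?F x - ereal (v \<bullet> (y - x))) / ereal (norm (y - x))"
    proof (cases "y \<in> D")
      case True
      have "- norm (f y - f x - (y - x) \<bullet> g) \<le> f y - f x - v \<bullet> (y - x)"
        using v[OF True] by (simp add: inner_commute)
      then have "?q y \<le> (f y - f x - v \<bullet> (y - x)) / norm (y - x)"
        using y divide_right_mono[of _ _ "norm (y - x)"] by fastforce
      then show ?thesis using True x y by (simp add: indicator_ereal_def)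
    next
      case False
      then show ?thesis using x y by (simp add: indicator_ereal_def)
    qed
  qed
  ultimately show ?thesis using x
    by (simp add: frechet_subdiff_def effective_domain_def indicator_ereal_def)
qed

lemma frechet_subset_limiting_subdiff:
  "frechet_subdiff g x \<subseteq> limiting_subdiff g x"
proof
  fix v assume v: "v \<in> frechet_subdiff g x"
  then have "x \<in> effective_domain g" by (simp add: frechet_subdiff_def)
  with v show "v \<in> limiting_subdiff g x"
    unfolding limiting_subdiff_def
    by (intro CollectI conjI exI[of _ "\<lambda>_. x"] exI[of _ "\<lambda>_. v"]) auto
qed

text \<open>The difference quotients of \<open>G\<close> from \<open>x\<close> towards
  \<open>y\<close> at times \<open>0 < t < 1\<close> are at most \<open>G y - G x\<close>, and the
  directional derivative is their limit as \<open>t\<close> decreases to 0.\<close>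

lemma convex_on_above_tangent:
  fixes G :: "'a::real_inner \<Rightarrow> real"
  assumes conv: "convex_on S G" and S: "x \<in> S" "y \<in> S" and g: "GDERIV G x :> g"
  shows "G x + g \<bullet> (y - x) \<le> G y"
proof -
  have "((\<lambda>t. G (x + t *\<^sub>R (y - x))) has_derivative (\<lambda>t. (t *\<^sub>R (y - x)) \<bullet> g)) (at 0)"
    by (rule has_derivative_compose[where g = G and f = "\<lambda>t. x + t *\<^sub>R (y - x)"])
       (use g in \<open>auto intro!: derivative_eq_intros simp: gderiv_def\<close>)
  then have der: "((\<lambda>t. G (x + t *\<^sub>R (y - x))) has_real_derivative g \<bullet> (y - x)) (at 0)"
    by (simp add: has_field_derivative_def inner_commute mult.commute[of _ "inner _ _"])
  have "((\<lambda>t. (G (x + t *\<^sub>R (y - x)) - G x) / t) \<longlongrightarrow> g \<bullet> (y - x)) (at_right 0)"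
    using der by (auto simp: has_field_derivative_iff intro: tendsto_within_subset)
  moreover have "eventually (\<lambda>t. (G (x + t *\<^sub>R (y - x)) - G x) / t \<le> G y - G x) (at_right (0::real))"
  proof (rule eventually_at_right_less[THEN eventually_elim2[rotated 1]])
    show "eventually (\<lambda>t. t < 1) (at_right (0::real))"
      by (rule order_tendstoD[where y = 0]) (auto intro: tendsto_intros)
    fix t :: real assume t: "t < 1" "0 < t"
    have "G ((1 - t) *\<^sub>R x + t *\<^sub>R y) \<le> (1 - t) * G x + t * G y"
      using t S by (intro convex_onD[OF conv]) auto
    moreover have "(1 - t) *\<^sub>R x + t *\<^sub>R y = x + t *\<^sub>R (y - x)"
      by (simp add: algebra_simps)
    ultimately show "(G (x + t *\<^sub>R (y - x)) - G x) / t \<le> G y - G x"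
      using t by (simp add: field_simps)
  qed
  ultimately have "g \<bullet> (y - x) \<le> G y - G x"
    by (intro tendsto_upperbound) auto
  then show ?thesis by simp
qed

section \<open>Boundedness from orthogonality and matching signs\<close>

text \<open>Used with \<open>W\<close> the kernel of \<open>A\<close>, \<open>d\<close> the steps
  and \<open>p\<close> the log steps. Dividing by \<open>norm (p k)\<close> along an unbounded
  subsequence makes \<open>q\<close> vanish, so a limit direction \<open>l\<close> is orthogonal to
  \<open>W\<close>; but late \<open>d k\<close> share the signs of \<open>l\<close> on its support,
  forcing a positive inner product.\<close>

lemma bounded_of_sign_matched_orthogonal:
  fixes p q d :: "nat \<Rightarrow> real ^ 'n"
  assumes W: "\<And>k w. w \<in> W \<Longrightarrow> (q k + p k) \<bullet> w = 0"
    and d: "\<And>k. d k \<in> W" and sgn: "\<And>k i. sgn (d k $ i) = sgn (p k $ i)"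
    and q: "bounded (range q)"
  shows "bounded (range p)"
proof (rule ccontr)
  assume unb: "\<not> bounded (range p)"
  have "\<exists>k. norm (p k) > real n" for n
    using unb by (force simp: bounded_iff not_le)
  then obtain r where r: "\<And>n. norm (p (r n)) > real n" by metis
  define u where "u n = p (r n) /\<^sub>R norm (p (r n))" for n
  have nz: "p (r n) \<noteq> 0" for n using r[of n] by auto
  have "\<forall>n. u n \<in> sphere 0 1" using nz by (simp add: u_def)
  then obtain l s where l: "l \<in> sphere 0 1" "strict_mono s" "(u \<circ> s) \<longlonglongrightarrow> l"
    using compact_sphere[of "0::real^'n" 1] unfolding compact_def by metis
  \<comment> \<open>\<open>r\<close> may fail to be increasing; the norms diverge because
    \<open>norm (p (r n)) > n\<close> and \<open>n \<le> s n\<close>.\<close>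
  have inf: "filterlim (\<lambda>n. norm (p (r (s n)))) at_top sequentially"
  proof (rule filterlim_at_top_mono[OF filterlim_real_sequentially])
    show "eventually (\<lambda>n. real n \<le> norm (p (r (s n)))) sequentially"
      using r seq_suble[OF l(2)] by (intro always_eventually) (meson less_imp_le of_nat_mono order_trans)
  qed
  obtain Q where Q: "\<And>k. norm (q k) \<le> Q" using q by (auto simp: bounded_iff)
  have Wl: "l \<bullet> w = 0" if "w \<in> W" for w
  proof -
    have "(\<lambda>n. inverse (norm (p (r (s n)))) * (- (q (r (s n)) \<bullet> w))) \<longlonglongrightarrow> 0"
    proof (rule Lim_null_comparison)
      have b: "\<bar>q k \<bullet> w\<bar> \<le> Q * norm w" for k
        using Cauchy_Schwarz_ineq2[of "q k" w] mult_right_mono[OF Q[of k], of "norm w"] by simp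
      show "eventually (\<lambda>n. norm (inverse (norm (p (r (s n)))) * (- (q (r (s n)) \<bullet> w)))
          \<le> inverse (norm (p (r (s n)))) * (Q * norm w)) sequentially"
        using b by (intro always_eventually) (auto simp: abs_mult intro!: mult_left_mono)
      show "(\<lambda>n. inverse (norm (p (r (s n)))) * (Q * norm w)) \<longlonglongrightarrow> 0"
        by (rule tendsto_mult_left_zero) (rule tendsto_inverse_0_at_top[OF inf])
    qed
    moreover have "inverse (norm (p (r (s n)))) * (- (q (r (s n)) \<bullet> w)) = (u \<circ> s) n \<bullet> w" for n
    proof -
      have "- (q (r (s n)) \<bullet> w) = p (r (s n)) \<bullet> w"
        using W[OF that, of "r (s n)"] by (simp add: inner_add_left)
      then show ?thesis by (simp add: u_def)
    qed
    ultimately have "(\<lambda>n. (u \<circ> s) n \<bullet> w) \<longlonglongrightarrow> 0" by simp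
    moreover have "(\<lambda>n. (u \<circ> s) n \<bullet> w) \<longlonglongrightarrow> l \<bullet> w"
      by (intro tendsto_intros l)
    ultimately show ?thesis using LIMSEQ_unique by blast
  qed
  \<comment> \<open>Where \<open>l $ i = 0\<close> the sign of \<open>d\<close> is uncontrolled, but
    such coordinates contribute nothing to the inner product with \<open>l\<close>.\<close>
  have ev: "eventually (\<lambda>n. l $ i \<noteq> 0 \<longrightarrow> l $ i * d (r (s n)) $ i > 0) sequentially" for i
  proof (cases "l $ i = 0")
    case False
    have "(\<lambda>n. l $ i * (u \<circ> s) n $ i) \<longlonglongrightarrow> l $ i * l $ i"
      by (intro tendsto_intros l)
    moreover have "l $ i * l $ i > 0" using False by (metis not_real_square_gt_zero)
    ultimately have "eventually (\<lambda>n. l $ i * (u \<circ> s) n $ i > 0) sequentially"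
      by (rule order_tendstoD)
    then show ?thesis
    proof eventually_elim
      case (elim n)
      have "sgn (d (r (s n)) $ i) = sgn ((u \<circ> s) n $ i)"
        using sgn[of "r (s n)" i] nz[of "s n"] by (simp add: u_def sgn_mult)
      then have "sgn (l $ i * d (r (s n)) $ i) = sgn (l $ i * (u \<circ> s) n $ i)"
        by (simp add: sgn_mult)
      then show ?case using elim by (metis sgn_greater)
    qed
  qed simp
  then have "eventually (\<lambda>n. \<forall>i. l $ i \<noteq> 0 \<longrightarrow> l $ i * d (r (s n)) $ i > 0) sequentially"
    by (simp add: eventually_all_finite)
  then obtain n where n: "\<And>i. l $ i \<noteq> 0 \<Longrightarrow> l $ i * d (r (s n)) $ i > 0"
    by (auto simp: eventually_sequentially)
  have "l \<noteq> 0" using l by auto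
  then obtain j where j: "l $ j \<noteq> 0" by (auto simp: vec_eq_iff)
  have "l \<bullet> d (r (s n)) > 0"
    unfolding inner_vec_def
    by (rule sum_pos2[of _ j]) (use n j in \<open>auto, metis less_imp_le mult_zero_left order_refl\<close>)
  then show False using Wl[OF d] by simp
qed

section \<open>One entropic proximal step over a polyhedron: positivity, stationarity,
  descent\<close>

text \<open>On the positive orthant this is the gradient of the entropy up to the all-ones vector,
  which cancels in differences.\<close>

definition log_vec :: "real ^ 'n \<Rightarrow> real ^ 'n" where
  "log_vec x = (\<chi> i. ln (x $ i))"

lemma convex_polyhedron_eq: "convex (polyhedron_eq A b)"
  unfolding convex_def polyhedron_eq_def nonneg_orthant_def
  by (auto simp: matrix_vector_right_distrib matrix_vector_mult_scaleR
      simp flip: scaleR_add_left)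

lemma closed_polyhedron_eq: "closed (polyhedron_eq A b)"
proof -
  have "polyhedron_eq A b = {x. A *v x = b} \<inter> (\<Inter>i. {x. 0 \<le> x $ i})"
    by (auto simp: polyhedron_eq_def nonneg_orthant_def)
  then show ?thesis
    by (auto intro!: closed_Int closed_INT closed_Collect_eq closed_Collect_le continuous_intros
        matrix_vector_mult_linear_continuous_on)
qed

text \<open>The left side is the tangent to \<open>s * ln s\<close> at \<open>u\<close>; the bound
  is \<open>ln v \<le> v - 1\<close> at \<open>v = u / s\<close>.\<close>

lemma xlnx_above_tangent:
  fixes s u :: real
  assumes "0 \<le> s" "0 < u"
  shows "s * ln u + s - u \<le> s * ln s"
proof (cases "s = 0")
  case False
  then have "s > 0" using assms by simp
  then have "s * ln (u / s) \<le> s * (u / s - 1)"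
    using assms by (intro mult_left_mono ln_le_minus_one) auto
  then show ?thesis using \<open>s > 0\<close> assms by (simp add: ln_div algebra_simps)
qed (use assms in simp)

text \<open>Averaging the tangent at the intermediate point \<open>u\<close> over the two endpoints
  gives exactly \<open>u * ln u\<close>.\<close>

lemma xlnx_convex:
  fixes x y t :: real
  assumes "0 \<le> y" "0 < x" "0 < t" "t \<le> 1"
  shows "(y + t * (x - y)) * ln (y + t * (x - y)) - y * ln y \<le> t * (x * ln x - y * ln y)"
proof -
  define u where "u = y + t * (x - y)"
  have "u = (1 - t) * y + t * x" by (simp add: u_def algebra_simps)
  then have "u > 0" using assms by (simp add: add_nonneg_pos)
  have "(1 - t) * (y * ln u + y - u) + t * (x * ln u + x - u)
      \<le> (1 - t) * (y * ln y) + t * (x * ln x)"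
    using assms \<open>u > 0\<close> by (intro add_mono mult_left_mono xlnx_above_tangent) auto
  moreover have "(1 - t) * (y * ln u + y - u) + t * (x * ln u + x - u) = u * ln u"
    by (simp add: u_def algebra_simps)
  ultimately show ?thesis unfolding u_def[symmetric] by (simp add: algebra_simps)
qed

text \<open>Moving from a boundary point towards an interior one changes the entropy by
  \<open>t ln t\<close> to leading order, which beats every term linear in \<open>t\<close>.\<close>

lemma entropic_prox_minimizer_pos:
  fixes x y g :: "real ^ 'n"
  assumes D: "convex D" "D \<subseteq> nonneg_orthant" and x: "x \<in> D" "x \<in> pos_orthant" and "0 < a"
    and min: "is_arg_min (\<lambda>z. c + g \<bullet> (z - x) + 1 / a * bregman_distance shannon_entropy z x)
      (\<lambda>z. z \<in> D) y"
  shows "y \<in> pos_orthant"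
proof (rule ccontr)
  assume "y \<notin> pos_orthant"
  have y: "y \<in> D" using min by (simp add: is_arg_min_def)
  have xpos: "x $ i > 0" for i using x by (simp add: pos_orthant_def)
  have ynn: "y $ i \<ge> 0" for i using D y by (auto simp: nonneg_orthant_def)
  obtain j where j: "y $ j = 0"
    using \<open>y \<notin> pos_orthant\<close> ynn by (auto simp: pos_orthant_def less_le)
  let ?h = "shannon_entropy :: real ^ 'n \<Rightarrow> real"
  \<comment> \<open>\<open>E\<close> collects the terms linear in \<open>t\<close> of the objective
    change. The choice of \<open>t\<close> makes \<open>ln t * x $ j / a\<close> equal to
    \<open>- (\<bar>E\<bar> + 1)\<close>, which outweighs \<open>E\<close>.\<close>
  define E where "E = g \<bullet> (x - y) + 1 / a * (?h x - ?h y - gradient ?h x \<bullet> (x - y))"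
  define t where "t = exp (- ((\<bar>E\<bar> + 1) * a / x $ j))"
  have t: "0 < t" "t < 1" using \<open>0 < a\<close> xpos[of j] by (auto simp: t_def)
  define z where "z = y + t *\<^sub>R (x - y)"
  have "z = (1 - t) *\<^sub>R y + t *\<^sub>R x" by (simp add: z_def algebra_simps)
  then have "z \<in> D" using convexD[OF D(1) y x(1), of "1 - t" t] t by simp
  have "?h z - ?h y \<le> (\<Sum>i\<in>UNIV. t * (x $ i * ln (x $ i) - y $ i * ln (y $ i))
      + (if i = j then t * ln t * x $ j else 0))"
    unfolding shannon_entropy_def sum_subtractf[symmetric]
  proof (rule sum_mono)
    fix i
    show "z $ i * ln (z $ i) - y $ i * ln (y $ i) \<le> t * (x $ i * ln (x $ i) - y $ i * ln (y $ i))
      + (if i = j then t * ln t * x $ j else 0)"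
    proof (cases "i = j")
      \<comment> \<open>Here \<open>z $ j = t * x $ j\<close>, and its logarithm splits off the
        extra term \<open>t * ln t * x $ j\<close>.\<close>
      case True
      then show ?thesis using j t xpos[of j] by (simp add: z_def ln_mult algebra_simps)
    next
      case False
      then show ?thesis using xlnx_convex[OF ynn xpos, of t i] t by (simp add: z_def)
    qed
  qed
  also have "\<dots> = t * (?h x - ?h y) + t * ln t * x $ j"
    by (simp add: sum.distrib sum_subtractf shannon_entropy_def flip: sum_distrib_left)
  finally have h: "?h z - ?h y \<le> t * (?h x - ?h y) + t * ln t * x $ j" .
  have "z - x = (y - x) + t *\<^sub>R (x - y)" by (simp add: z_def)
  have "c + g \<bullet> (y - x) + 1 / a * bregman_distance ?h y x
      \<le> c + g \<bullet> (z - x) + 1 / a * bregman_distance ?h z x"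
    using min \<open>z \<in> D\<close> by (force simp: is_arg_min_def)
  then have "0 \<le> t * (g \<bullet> (x - y)) + 1 / a * (?h z - ?h y - t * (gradient ?h x \<bullet> (x - y)))"
    unfolding bregman_distance_def \<open>z - x = _\<close>
    by (simp add: inner_add_right diff_divide_distrib add_divide_distrib)
  also have "\<dots> \<le> t * (g \<bullet> (x - y))
      + 1 / a * (t * (?h x - ?h y) + t * ln t * x $ j - t * (gradient ?h x \<bullet> (x - y)))"
    using h \<open>0 < a\<close> by (intro add_left_mono mult_left_mono diff_right_mono) auto
  also have "\<dots> = t * (E + ln t * x $ j / a)"
    using \<open>0 < a\<close> by (simp add: E_def field_simps)
  also have "ln t * x $ j / a = - (\<bar>E\<bar> + 1)"
    using \<open>0 < a\<close> xpos[of j] by (simp add: t_def)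
  finally have "0 \<le> E - (\<bar>E\<bar> + 1)" using t by (simp add: zero_le_mult_iff)
  then show False by linarith
qed

lemma eventually_pos_orthant:
  assumes "y \<in> pos_orthant"
  shows "eventually (\<lambda>z. z \<in> pos_orthant) (nhds y)"
proof -
  have "eventually (\<lambda>z. 0 < z $ i) (nhds y)" for i
    using assms by (intro order_tendstoD[where y = "y $ i"] tendsto_intros filterlim_ident)
      (auto simp: pos_orthant_def)
  then show ?thesis by (simp add: pos_orthant_def eventually_all_finite)
qed

text \<open>As \<open>y\<close> is positive, moving along \<open>w\<close> stays feasible for small
  parameters of both signs, so the derivative along \<open>w\<close> vanishes. Orthogonality to the
  kernel of \<open>A\<close> stands in for a multiplier.\<close>

lemma entropic_prox_stationary:
  fixes x y g w :: "real ^ 'n"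
  assumes x: "x \<in> pos_orthant" and y: "y \<in> pos_orthant" and "0 < a"
    and min: "is_arg_min (\<lambda>z. c + g \<bullet> (z - x) + 1 / a * bregman_distance shannon_entropy z x)
      (\<lambda>z. z \<in> polyhedron_eq A b) y"
    and w: "A *v w = 0"
  shows "(a *\<^sub>R g + (log_vec y - log_vec x)) \<bullet> w = 0"
proof -
  let ?phi = "\<lambda>z. c + g \<bullet> (z - x) + 1 / a * bregman_distance shannon_entropy z x"
  let ?l = "\<lambda>t::real. y + t *\<^sub>R w"
  have gx: "gradient shannon_entropy x = (\<chi> i. ln (x $ i) + 1)"
    by (rule GDERIV_gradient_eq[OF GDERIV_shannon_entropy[OF x]])
  have "((\<lambda>t. shannon_entropy (?l t)) has_derivative
      (\<lambda>t. (t *\<^sub>R w) \<bullet> (\<chi> i. ln (y $ i) + 1))) (at 0)"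
    by (rule has_derivative_compose[where g = shannon_entropy and f = ?l])
      (use GDERIV_shannon_entropy[OF y] in \<open>auto intro!: derivative_eq_intros simp: gderiv_def\<close>)
  then have dh: "((\<lambda>t. shannon_entropy (?l t)) has_real_derivative
      (\<chi> i. ln (y $ i) + 1) \<bullet> w) (at 0)"
    by (simp add: has_field_derivative_def inner_commute mult.commute[of _ "inner _ _"])
  have dl: "((\<lambda>t. v \<bullet> (?l t - x)) has_real_derivative v \<bullet> w) (at 0)" for v
    unfolding has_field_derivative_def
    by (auto intro!: derivative_eq_intros simp: fun_eq_iff)
  have d: "((\<lambda>t. ?phi (?l t)) has_real_derivative
      g \<bullet> w + 1 / a * ((\<chi> i. ln (y $ i) + 1) \<bullet> w - (\<chi> i. ln (x $ i) + 1) \<bullet> w)) (at 0)"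
    unfolding bregman_distance_def gx
    by (auto intro!: derivative_eq_intros dh dl simp: less_imp_neq[OF \<open>0 < a\<close>, symmetric])
  have "((\<lambda>t. ?l t) \<longlongrightarrow> y) (nhds (0::real))"
    by (auto intro!: tendsto_eq_intros filterlim_ident)
  then have "eventually (\<lambda>t. ?l t \<in> pos_orthant) (nhds (0::real))"
    using eventually_pos_orthant[OF y] unfolding filterlim_iff by blast
  then obtain d where "d > 0" and d': "\<And>t. \<bar>t\<bar> < d \<Longrightarrow> ?l t \<in> pos_orthant"
    by (auto simp: eventually_nhds_metric dist_real_def)
  have "?l t \<in> polyhedron_eq A b" if "\<bar>t\<bar> < d" for t
    using d'[OF that] w min
    by (auto simp: polyhedron_eq_def pos_orthant_def nonneg_orthant_def is_arg_min_def
        matrix_vector_right_distrib matrix_vector_mult_scaleR less_imp_le)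
  then have "?phi (?l 0) \<le> ?phi (?l t)" if "\<bar>0 - t\<bar> < d" for t
    using min that by (force simp: is_arg_min_def)
  then have "g \<bullet> w + 1 / a * ((\<chi> i. ln (y $ i) + 1) \<bullet> w - (\<chi> i. ln (x $ i) + 1) \<bullet> w) = 0"
    by (intro DERIV_local_min[OF d \<open>d > 0\<close>]) blast
  moreover have "(\<chi> i. ln (y $ i) + 1) \<bullet> w - (\<chi> i. ln (x $ i) + 1) \<bullet> w
      = (log_vec y - log_vec x) \<bullet> w"
    unfolding inner_diff_left[symmetric]
    by (rule arg_cong[where f = "\<lambda>v. v \<bullet> w"]) (simp add: log_vec_def vec_eq_iff)
  ultimately show ?thesis
    unfolding inner_add_left inner_scaleR_left using \<open>0 < a\<close> by (simp add: field_simps)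
qed

text \<open>Relative smoothness bounds the error by \<open>L\<close> times the Bregman distance of
  \<open>y\<close> from \<open>x\<close>. Adding the nonnegative distance of \<open>x\<close> from
  \<open>y\<close> symmetrises it into the inner product that stationarity also produces.\<close>

lemma relatively_smooth_descent:
  fixes x y g :: "real ^ 'n"
  assumes rs: "relatively_smooth_on D shannon_entropy L f" and "0 \<le> L"
    and D: "x \<in> D" "y \<in> D" and x: "x \<in> pos_orthant" and y: "y \<in> pos_orthant"
    and g: "GDERIV f x :> g"
  shows "f y \<le> f x + g \<bullet> (y - x) + L * ((log_vec y - log_vec x) \<bullet> (y - x))"
proof -
  let ?gh = "\<chi> i. ln (x $ i) + 1"
  have "GDERIV (\<lambda>z. L * shannon_entropy z - f z) x :> L *\<^sub>R ?gh - g"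
    unfolding gderiv_def
    using has_derivative_diff[OF has_derivative_mult_right[OF GDERIV_shannon_entropy[OF x, unfolded gderiv_def]]
        g[unfolded gderiv_def], of L]
    by (simp add: inner_diff_right)
  from convex_on_above_tangent[OF rs[unfolded relatively_smooth_on_def] D this]
  have "f y \<le> f x + g \<bullet> (y - x) + L * (shannon_entropy y - shannon_entropy x - ?gh \<bullet> (y - x))"
    by (simp add: inner_diff_left algebra_simps)
  moreover have "shannon_entropy y - shannon_entropy x - ?gh \<bullet> (y - x)
      \<le> (log_vec y - log_vec x) \<bullet> (y - x)"
    unfolding shannon_entropy_def inner_vec_def sum_subtractf[symmetric]
  proof (rule sum_mono)
    fix i
    have "x $ i * ln (y $ i) + x $ i - y $ i \<le> x $ i * ln (x $ i)"
      using x y by (intro xlnx_above_tangent) (auto simp: pos_orthant_def less_imp_le)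
    then show "y $ i * ln (y $ i) - x $ i * ln (x $ i) - ?gh $ i \<bullet> (y - x) $ i
        \<le> (log_vec y - log_vec x) $ i \<bullet> (y - x) $ i"
      by (simp add: log_vec_def algebra_simps)
  qed
  ultimately show ?thesis
    using \<open>0 \<le> L\<close> mult_left_mono by fastforce
qed

section \<open>Step length and descent measured by the log step\<close>

text \<open>With \<open>p\<close> the log step, \<open>y - x = x * (exp p - 1)\<close>, and the mean
  value theorem gives \<open>exp p - 1 = p * exp c\<close> with
  \<open>\<bar>c\<bar> \<le> P\<close>. Both bounds come from
  \<open>exp (- P) \<le> exp c \<le> exp P\<close>.\<close>

lemma log_step_bounds:
  fixes x y :: real
  assumes "0 < x" "0 < y" and P: "\<bar>ln y - ln x\<bar> \<le> P"
  shows "exp (- P) * (x * (ln y - ln x)^2) \<le> (ln y - ln x) * (y - x)"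
    and "\<bar>y - x\<bar> \<le> exp P * (x * \<bar>ln y - ln x\<bar>)"
proof -
  define p where "p = ln y - ln x"
  have y: "y = x * exp p" using assms by (simp add: p_def exp_diff)
  obtain c where c: "\<bar>c\<bar> \<le> P" "exp p - 1 = p * exp c"
  proof (cases p "0::real" rule: linorder_cases)
    case less
    from MVT2[OF this, of exp exp] obtain c where "p < c" "c < 0" "1 - exp p = - p * exp c"
      by (auto intro: DERIV_exp)
    then show ?thesis using P that[of c] by (auto simp: p_def[symmetric])
  next
    case greater
    from MVT2[OF this, of exp exp] obtain c where "0 < c" "c < p" "exp p - 1 = p * exp c"
      by (auto intro: DERIV_exp)
    then show ?thesis using P that[of c] by (auto simp: p_def[symmetric])
  qed (use P that[of 0] in auto)
  have e: "exp (- P) \<le> exp c" "exp c \<le> exp P" using c by auto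
  have yx: "y - x = x * (p * exp c)" using c(2) by (simp add: y algebra_simps)
  have "exp (- P) * (x * p^2) \<le> exp c * (x * p^2)"
    using e assms by (intro mult_right_mono) auto
  then show "exp (- P) * (x * (ln y - ln x)^2) \<le> (ln y - ln x) * (y - x)"
    unfolding p_def[symmetric] yx by (simp add: power2_eq_square algebra_simps)
  have "exp c * (x * \<bar>p\<bar>) \<le> exp P * (x * \<bar>p\<bar>)"
    using e assms by (intro mult_right_mono) auto
  then show "\<bar>y - x\<bar> \<le> exp P * (x * \<bar>ln y - ln x\<bar>)"
    unfolding p_def[symmetric] yx using assms by (simp add: abs_mult algebra_simps)
qed

text \<open>\<open>s\<close> carries the weight of the SKL inequality. For the second bound
  \<open>x $ i\<close> is split into two roots: one enters \<open>s\<close>, the other is at most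
  \<open>sqrt R\<close>.\<close>

lemma log_vec_step_bounds:
  fixes x y :: "real ^ 'n"
  assumes x: "x \<in> pos_orthant" and y: "y \<in> pos_orthant"
    and P: "norm (log_vec y - log_vec x) \<le> P" and R: "norm x \<le> R"
  defines "s \<equiv> norm (diag_sqrt x (log_vec y - log_vec x))"
  shows "exp (- P) * s^2 \<le> (log_vec y - log_vec x) \<bullet> (y - x)"
    and "norm (y - x) \<le> exp P * sqrt R * s"
proof -
  define p where "p = log_vec y - log_vec x"
  have pos: "x $ i > 0" "y $ i > 0" for i using x y by (auto simp: pos_orthant_def)
  have pi: "p $ i = ln (y $ i) - ln (x $ i)" for i by (simp add: p_def log_vec_def)
  have Pi: "\<bar>ln (y $ i) - ln (x $ i)\<bar> \<le> P" for i
    using component_le_norm_cart[of p i] P unfolding pi unfolding p_def by linarith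
  note b = log_step_bounds[OF pos Pi, folded pi]
  have s: "s^2 = (\<Sum>i\<in>UNIV. x $ i * (p $ i)^2)"
    unfolding s_def p_def[symmetric] power2_norm_eq_inner inner_vec_def
    by (rule sum.cong) (use abs_of_pos[OF pos(1)] in \<open>auto simp: diag_sqrt_def power2_eq_square\<close>)
  show "exp (- P) * s^2 \<le> (log_vec y - log_vec x) \<bullet> (y - x)"
    unfolding s sum_distrib_left inner_vec_def p_def[symmetric]
    by (rule sum_mono) (use b in simp)
  have "norm (y - x) \<le> norm ((exp P * sqrt R) *\<^sub>R diag_sqrt x p)"
  proof (rule norm_le_componentwise_cart)
    fix i
    have "x $ i * \<bar>p $ i\<bar> = sqrt (x $ i) * (sqrt (x $ i) * \<bar>p $ i\<bar>)"
      using pos[of i] by (simp flip: mult.assoc)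
    also have "\<dots> \<le> sqrt R * (sqrt (x $ i) * \<bar>p $ i\<bar>)"
      using component_le_norm_cart[of x i] R pos[of i] by (intro mult_right_mono) auto
    finally have "exp P * (x $ i * \<bar>p $ i\<bar>) \<le> exp P * (sqrt R * (sqrt (x $ i) * \<bar>p $ i\<bar>))"
      by (intro mult_left_mono) auto
    from order_trans[OF b(2) this] show "norm ((y - x) $ i) \<le> norm (((exp P * sqrt R) *\<^sub>R diag_sqrt x p) $ i)"
      using pos[of i] R order_trans[OF norm_ge_zero R] by (simp add: diag_sqrt_def abs_mult mult.assoc)
  qed
  then show "norm (y - x) \<le> exp P * sqrt R * s"
    using order_trans[OF norm_ge_zero R] by (simp add: s_def p_def abs_mult)
qed

section \<open>Convergence from a desingularizing function\<close>

text \<open>The tangent to the concave \<open>\<phi>\<close> at \<open>t\<close> lies above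
  \<open>\<phi>\<close>. The base point is positive, where \<open>\<phi>\<close> is differentiable,
  while \<open>u = 0\<close> is allowed because the limit value may be reached.\<close>

lemma desingularizing_decrease:
  assumes des: "desingularizing \<eta> \<phi> \<phi>'" and "0 \<le> u" "0 < t" "ereal u < \<eta>" "ereal t < \<eta>"
  shows "\<phi>' t * (t - u) \<le> \<phi> t - \<phi> u"
proof -
  have "(\<phi> has_real_derivative \<phi>' t) (at t)" using des assms by (simp add: desingularizing_def)
  from DERIV_minus[OF this] have "GDERIV (\<lambda>t. - \<phi> t) t :> - \<phi>' t"
    unfolding gderiv_def has_field_derivative_def
    by (rule has_derivative_eq_rhs) (auto simp: fun_eq_iff)
  from convex_on_above_tangent[OF _ _ _ this, of "{t. 0 \<le> t \<and> ereal t < \<eta>}" u]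
  show ?thesis using des assms
    by (simp add: desingularizing_def concave_on_def algebra_simps)
qed

text \<open>Since the gradient bound at \<open>x k\<close> is paired with the decrease from \<open>x k\<close> to \<open>x (Suc k)\<close>,
  each step length is bounded outright by a telescoping difference of \<open>\<phi> \<circ> r\<close>.\<close>

lemma KL_convergence:
  fixes x :: "nat \<Rightarrow> 'a::real_normed_vector" and r s :: "nat \<Rightarrow> real"
  assumes des: "desingularizing \<eta> \<phi> \<phi>'" and "0 < \<eta>" and U: "open U" "z \<in> U"
    and r: "\<And>k. 0 \<le> r k" "r \<longlonglongrightarrow> 0"
    and s: "\<And>k. 0 \<le> s k" and "0 < B" "0 < c" "0 \<le> C"
    and decrease: "\<And>k. c * (s k)^2 \<le> r k - r (Suc k)"
    and step: "\<And>k. norm (x (Suc k) - x k) \<le> C * s k"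
    and KL: "\<And>k. x k \<in> U \<Longrightarrow> 0 < r k \<Longrightarrow> ereal (r k) < \<eta> \<Longrightarrow> 1 \<le> \<phi>' (r k) * (B * s k)"
    and subseq: "strict_mono \<rho>" "(x \<circ> \<rho>) \<longlonglongrightarrow> z"
  shows "x \<longlonglongrightarrow> z"
proof (rule LIMSEQ_I)
  fix e :: real assume "0 < e"
  obtain e0 where e0: "e0 > 0" "ball z e0 \<subseteq> U" using U by (auto simp: open_contains_ball)
  define \<epsilon> where "\<epsilon> = min e e0"
  have \<epsilon>: "\<epsilon> > 0" "\<epsilon> \<le> e" "ball z \<epsilon> \<subseteq> U" using e0 \<open>0 < e\<close> by (auto simp: \<epsilon>_def)
  \<comment> \<open>Steps are at most \<open>C * s k\<close>, and \<open>s k\<close> will be at most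
    \<open>B / c\<close> times the drop of \<open>\<phi>\<close>.\<close>
  define M where "M = C * B / c"
  have "M \<ge> 0" using \<open>0 < B\<close> \<open>0 < c\<close> \<open>0 \<le> C\<close> by (simp add: M_def)
  have anti: "r (Suc k) \<le> r k" for k
    using decrease[of k] \<open>0 < c\<close> by (smt (verit) mult_nonneg_nonneg zero_le_power2)
  have bound: "C * s k \<le> M * (\<phi> (r k) - \<phi> (r (Suc k)))" if "x k \<in> U" "ereal (r k) < \<eta>" for k
  proof (cases "r k = 0")
    \<comment> \<open>The limit value is reached: the KL bound is silent, but the decrease forces
      \<open>s k = 0\<close>.\<close>
    case True
    then have "r (Suc k) = 0" using anti[of k] r(1)[of "Suc k"] by simp
    then have "c * (s k)^2 \<le> 0" using decrease[of k] True by simp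
    then have "s k = 0" using \<open>0 < c\<close> by (simp add: mult_le_0_iff)
    then show ?thesis using True \<open>r (Suc k) = 0\<close> by simp
  next
    case False
    then have "r k > 0" using r(1)[of k] by simp
    note KL = KL[OF that(1) this that(2)]
    have "s k \<noteq> 0" using KL by auto
    then have "s k > 0" using s[of k] by simp
    have p: "\<phi>' (r k) > 0" using des \<open>r k > 0\<close> that by (simp add: desingularizing_def)
    have "ereal (r (Suc k)) < \<eta>" using anti[of k] that(2) by (meson ereal_less_eq(3) le_less_trans)
    then have d: "\<phi>' (r k) * (r k - r (Suc k)) \<le> \<phi> (r k) - \<phi> (r (Suc k))"
      using des r(1) \<open>r k > 0\<close> that by (intro desingularizing_decrease) auto
    \<comment> \<open>Scaling the KL bound by \<open>c * s k / B\<close> produces the square from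
      the decrease on the right and leaves one factor \<open>s k\<close> on the left.\<close>
    have "c * s k / B * 1 \<le> c * s k / B * (\<phi>' (r k) * (B * s k))"
      using KL \<open>0 < c\<close> \<open>0 < B\<close> \<open>0 < s k\<close> by (intro mult_left_mono) auto
    also have "\<dots> = \<phi>' (r k) * (c * (s k)^2)"
      using \<open>0 < B\<close> by (simp add: power2_eq_square)
    also have "\<dots> \<le> \<phi>' (r k) * (r k - r (Suc k))"
      using p decrease by (intro mult_left_mono) auto
    also note d
    finally have "C * B / c * (c * s k / B) \<le> M * (\<phi> (r k) - \<phi> (r (Suc k)))"
      unfolding M_def[symmetric] using \<open>0 \<le> M\<close> by (intro mult_left_mono) auto
    then show ?thesis using \<open>0 < c\<close> \<open>0 < B\<close> by simp
  qed
  have r\<eta>: "eventually (\<lambda>k. ereal (r k) < \<eta>) sequentially"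
    using r(2) \<open>0 < \<eta>\<close> by (intro order_tendstoD(2)[where y = "ereal 0"]) (auto simp: zero_ereal_def)
  have "(\<lambda>k. \<phi> (r k)) \<longlonglongrightarrow> \<phi> 0"
    by (rule continuous_on_tendsto_compose[of "{t. 0 \<le> t \<and> ereal t < \<eta>}"])
      (use des r r\<eta> \<open>0 < \<eta>\<close> in \<open>auto simp: desingularizing_def zero_ereal_def\<close>)
  then have "(\<lambda>k. M * \<phi> (r k)) \<longlonglongrightarrow> 0"
    using des by (simp add: desingularizing_def tendsto_mult_right_zero)
  then have "eventually (\<lambda>k. M * \<phi> (r k) < \<epsilon> / 2) sequentially"
    using \<epsilon> by (intro order_tendstoD) auto
  with r\<eta> have "eventually (\<lambda>k. ereal (r k) < \<eta> \<and> M * \<phi> (r k) < \<epsilon> / 2) sequentially"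
    by (rule eventually_conj)
  then have "eventually (\<lambda>n. ereal (r (\<rho> n)) < \<eta> \<and> M * \<phi> (r (\<rho> n)) < \<epsilon> / 2) sequentially"
    by (rule eventually_subseq[OF subseq(1)])
  moreover have "eventually (\<lambda>n. norm (x (\<rho> n) - z) < \<epsilon> / 2) sequentially"
    using tendstoD[OF subseq(2), of "\<epsilon> / 2"] \<epsilon> by (simp add: dist_norm)
  ultimately have "eventually (\<lambda>n. (ereal (r (\<rho> n)) < \<eta> \<and> M * \<phi> (r (\<rho> n)) < \<epsilon> / 2)
      \<and> norm (x (\<rho> n) - z) < \<epsilon> / 2) sequentially"
    by (rule eventually_conj)
  \<comment> \<open>The initial distance and the total remaining length
    \<open>M * \<phi> (r K)\<close> each take half of \<open>\<epsilon>\<close>.\<close>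
  then obtain K where K: "ereal (r K) < \<eta>" "M * \<phi> (r K) < \<epsilon> / 2" "norm (x K - z) < \<epsilon> / 2"
    by (auto simp: eventually_sequentially)
  \<comment> \<open>Joint induction: lying in the ball, hence in \<open>U\<close>, licenses
    \<open>bound\<close> at \<open>k\<close>; the telescoped estimate with \<open>\<phi>\<close>
    nonnegative then keeps the next iterate in the ball.\<close>
  have near: "ereal (r k) < \<eta> \<and> norm (x k - z) \<le> norm (x K - z) + M * (\<phi> (r K) - \<phi> (r k))
      \<and> norm (x k - z) < \<epsilon>" if "K \<le> k" for k
    using that
  proof (induction k rule: dec_induct)
    case base
    show ?case using K \<epsilon> by simp
  next
    case (step k)
    have "x k \<in> U" using step.IH \<epsilon> by (auto simp: dist_norm norm_minus_commute)
    have \<eta>: "ereal (r (Suc k)) < \<eta>"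
      using anti[of k] step.IH by (meson ereal_less_eq(3) le_less_trans)
    then have "M * \<phi> (r (Suc k)) \<ge> 0" using des r(1) \<open>0 \<le> M\<close> by (simp add: desingularizing_def)
    moreover have "norm (x (Suc k) - z) \<le> norm (x (Suc k) - x k) + norm (x k - z)"
      using norm_triangle_ineq[of "x (Suc k) - x k" "x k - z"] by simp
    \<comment> \<open>\<open>assms(12)\<close> is the hypothesis that bounds step lengths by
      \<open>C * s k\<close>.\<close>
    moreover have "norm (x (Suc k) - x k) \<le> M * (\<phi> (r k) - \<phi> (r (Suc k)))"
      using assms(12)[of k] bound[OF \<open>x k \<in> U\<close>] step.IH by linarith
    ultimately show ?case using \<eta> step.IH K by (simp add: right_diff_distrib)
  qed
  then show "\<exists>K. \<forall>k\<ge>K. norm (x k - z) < e" using \<epsilon> by (meson less_le_trans)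
qed

section \<open>First-order condition at the limit\<close>

text \<open>Summing the stationarity conditions telescopes the logarithms. On coordinates where \<open>z\<close>
  vanishes, \<open>- y $ i * ln (x K $ i)\<close> is bounded below because \<open>y $ i \<ge> 0\<close>, so the sums of
  \<open>\<alpha> k * (g k \<bullet> (y - z))\<close> cannot tend to \<open>- \<infinity>\<close>.\<close>

lemma variational_inequality_limit:
  fixes x g :: "nat \<Rightarrow> real ^ 'n"
  assumes x: "\<And>k. x k \<in> pos_orthant" and xz: "x \<longlonglongrightarrow> z" and g: "g \<longlonglongrightarrow> gz"
    and "0 < lo" and \<alpha>: "\<And>k. lo \<le> \<alpha> k"
    and stat: "\<And>k. (\<alpha> k *\<^sub>R g k + (log_vec (x (Suc k)) - log_vec (x k))) \<bullet> (y - z) = 0"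
    and y: "y \<in> nonneg_orthant"
  shows "0 \<le> gz \<bullet> (y - z)"
proof (rule ccontr)
  assume "\<not> 0 \<le> gz \<bullet> (y - z)"
  then have neg: "gz \<bullet> (y - z) < (gz \<bullet> (y - z)) / 2" by simp
  have pos: "x k $ i > 0" for k i using x by (simp add: pos_orthant_def)
  have xi: "(\<lambda>k. x k $ i) \<longlonglongrightarrow> z $ i" for i by (intro tendsto_intros xz)
  have z: "z $ i \<ge> 0" for i
    by (rule LIMSEQ_le_const[OF xi]) (use pos less_imp_le in blast)
  define \<Psi> where "\<Psi> k = - (log_vec (x k) \<bullet> (y - z))" for k
  have \<Psi>: "\<Psi> (Suc k) - \<Psi> k = \<alpha> k * (g k \<bullet> (y - z))" for k
    using stat[of k] by (simp add: \<Psi>_def inner_add_left inner_diff_left)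
  have "\<exists>\<beta>. \<forall>k. \<beta> \<le> - (ln (x k $ i) * (y $ i - z $ i))" for i
  proof (cases "z $ i = 0")
    case True
    have "Bseq (\<lambda>k. x k $ i)" using xi by (metis convergentI convergent_imp_Bseq)
    then obtain R where R: "R > 0" "\<And>k. \<bar>x k $ i\<bar> \<le> R" by (auto simp: Bseq_def)
    have "ln (x k $ i) \<le> ln R" for k using R(2)[of k] pos[of k i] R(1) by simp
    then have "ln (x k $ i) * y $ i \<le> ln R * y $ i" for k
      using y by (intro mult_right_mono) (auto simp: nonneg_orthant_def)
    then show ?thesis using True by (auto intro!: exI[of _ "- (ln R * y $ i)"])
  next
    case False
    then have "(\<lambda>k. - (ln (x k $ i) * (y $ i - z $ i))) \<longlonglongrightarrow> - (ln (z $ i) * (y $ i - z $ i))"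
      by (intro tendsto_intros xz) auto
    then have "Bseq (\<lambda>k. - (ln (x k $ i) * (y $ i - z $ i)))"
      by (metis convergentI convergent_imp_Bseq)
    then obtain R where "\<And>k. \<bar>- (ln (x k $ i) * (y $ i - z $ i))\<bar> \<le> R" by (auto simp: Bseq_def)
    then have "- R \<le> - (ln (x k $ i) * (y $ i - z $ i))" for k by (metis abs_le_D2 minus_le_iff)
    then show ?thesis by blast
  qed
  then obtain \<beta> where \<beta>: "\<And>i k. \<beta> i \<le> - (ln (x k $ i) * (y $ i - z $ i))" by metis
  have low: "sum \<beta> UNIV \<le> \<Psi> k" for k
    unfolding \<Psi>_def inner_vec_def log_vec_def sum_negf[symmetric]
    by (rule sum_mono) (use \<beta> in simp)
  \<comment> \<open>Past some \<open>N\<close> each step lowers \<open>\<Psi>\<close> by at least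
    \<open>\<delta>\<close>: the inner product is below half its negative limit, and since it is
    negative the lower bound \<open>lo\<close> on the step sizes gives the upper bound.\<close>
  define \<delta> where "\<delta> = - (lo * ((gz \<bullet> (y - z)) / 2))"
  have "\<delta> > 0" using neg \<open>0 < lo\<close> by (simp add: \<delta>_def mult_pos_neg)
  have "(\<lambda>k. g k \<bullet> (y - z)) \<longlonglongrightarrow> gz \<bullet> (y - z)" by (intro tendsto_intros g)
  from order_tendstoD(2)[OF this neg] obtain N
    where N: "\<And>k. k \<ge> N \<Longrightarrow> g k \<bullet> (y - z) < (gz \<bullet> (y - z)) / 2"
    by (auto simp: eventually_sequentially)
  have "\<Psi> (N + m) \<le> \<Psi> N - m * \<delta>" for m
  proof (induction m)
    case (Suc m)
    have gneg: "g (N + m) \<bullet> (y - z) < (gz \<bullet> (y - z)) / 2" by (rule N) simp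
    then have "\<alpha> (N + m) * (g (N + m) \<bullet> (y - z)) \<le> lo * (g (N + m) \<bullet> (y - z))"
      using neg by (intro mult_right_mono_neg \<alpha>) linarith
    also have "\<dots> \<le> - \<delta>"
      unfolding \<delta>_def minus_minus using gneg \<open>0 < lo\<close> by (intro mult_left_mono) auto
    finally show ?case using Suc \<Psi>[of "N + m"] by (simp add: distrib_right)
  qed simp
  moreover obtain m :: nat where "\<Psi> N - sum \<beta> UNIV < m * \<delta>"
    using reals_Archimedean3[OF \<open>\<delta> > 0\<close>] by blast
  ultimately show False using low[of "N + m"] by (smt (verit))
qed

text \<open>Identifies \<open>orthant_subdiff\<close> with \<open>limiting_subdiff\<close> for the
  objective, which is already \<infinity> off the orthant.\<close>

lemma extend_orthant_eq:
  assumes "D \<subseteq> nonneg_orthant"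
  shows "extend_orthant (\<lambda>y. ereal (f y) + indicator_ereal D y) = (\<lambda>y. ereal (f y) + indicator_ereal D y)"
  using assms by (auto simp: fun_eq_iff extend_orthant_def indicator_ereal_def)

section \<open>Convergence of the BPGM iterates to a critical point\<close>

theorem theorem1:
  fixes A :: "real ^ 'n ^ 'm" and b :: "real ^ 'm"
    and f :: "real ^ 'n \<Rightarrow> real" and F :: "real ^ 'n \<Rightarrow> ereal"
    and D :: "(real ^ 'n) set"
    and L \<alpha>_lo \<alpha>_hi :: real
    and \<alpha> :: "nat \<Rightarrow> real" and x :: "nat \<Rightarrow> real ^ 'n"
  defines "D \<equiv> polyhedron_eq A b"
    and "F \<equiv> (\<lambda>y. ereal (f y) + indicator_ereal D y)"
  assumes full_row_rank: "rank A = CARD('m)"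
    and strictly_feasible: "D \<inter> pos_orthant \<noteq> {}"
    and f_C1: "continuously_differentiable f"
    and L_pos: "0 < L"
    and rel_smooth: "relatively_smooth_on D shannon_entropy L f"
    and optimal_solution: "\<exists>y\<in>D. \<forall>z\<in>D. f y \<le> f z"
    and step_bounds: "0 < \<alpha>_lo" "\<alpha>_lo < \<alpha>_hi" "\<alpha>_hi < 1 / L"
    and steps: "\<And>k. \<alpha> k \<in> {\<alpha>_lo..\<alpha>_hi}"
    and bpgm: "bpgm_sequence f D \<alpha> x"
    and SKL: "SKL_function F"
    and bounded_seq: "bounded (range x)"
  shows "\<exists>x_bar. x \<longlonglongrightarrow> x_bar \<and> critical_point F x_bar"
proof -
  define g where "g k = gradient f (x k)" for k
  define p where "p k = log_vec (x (Suc k)) - log_vec (x k)" for k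
  define s where "s k = norm (diag_sqrt (x k) (p k))" for k
  have D_nonneg: "D \<subseteq> nonneg_orthant" by (auto simp: D_def polyhedron_eq_def)
  have ker: "A *v (y - z) = 0" if "y \<in> D" "z \<in> D" for y z
    using that by (simp add: D_def polyhedron_eq_def matrix_vector_mult_diff_distrib)
  have grad: "GDERIV f y :> gradient f y" for y
    using f_C1 by (intro GDERIV_gradient) (auto simp: continuously_differentiable_def differentiable_on_def)
  have f_cont: "isCont f y" for y
    using grad[of y] by (auto simp: gderiv_def intro: has_derivative_continuous)
  have grad_cont: "isCont (gradient f) y" for y
    using f_C1 by (simp add: continuously_differentiable_def continuous_on_eq_continuous_at)
  have \<alpha>: "\<alpha>_lo \<le> \<alpha> k" "0 < \<alpha> k" "\<alpha> k \<le> \<alpha>_hi" for k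
    using steps[of k] step_bounds by auto
  have xD: "x k \<in> D" for k
    using bpgm by (cases k) (auto simp: bpgm_sequence_def is_arg_min_def)
  have prox: "is_arg_min (\<lambda>y. f (x k) + g k \<bullet> (y - x k)
      + 1 / \<alpha> k * bregman_distance shannon_entropy y (x k)) (\<lambda>y. y \<in> D) (x (Suc k))" for k
    using bpgm by (simp add: bpgm_sequence_def g_def)
  \<comment> \<open>Positivity comes first: stationarity and descent differentiate the entropy at
    the iterates.\<close>
  have xpos: "x k \<in> pos_orthant" for k
  proof (induction k)
    case 0
    show ?case using bpgm by (simp add: bpgm_sequence_def)
  next
    case (Suc k)
    show ?case
      by (rule entropic_prox_minimizer_pos[OF _ D_nonneg xD Suc \<alpha>(2) prox])
        (simp add: D_def convex_polyhedron_eq)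
  qed
  have stat: "(\<alpha> k *\<^sub>R g k + p k) \<bullet> w = 0" if "A *v w = 0" for k w
    unfolding p_def
    by (rule entropic_prox_stationary[OF xpos xpos \<alpha>(2) prox[unfolded D_def] that])

  obtain R where R: "\<And>k. norm (x k) \<le> R" using bounded_seq by (auto simp: bounded_iff)
  have "bounded (range (\<lambda>k. \<alpha> k *\<^sub>R g k))"
  proof -
    have "bounded (gradient f ` cball 0 R)"
      using grad_cont by (intro compact_imp_bounded compact_continuous_image)
        (auto intro: continuous_at_imp_continuous_on)
    then obtain G where G: "\<And>k. norm (g k) \<le> G"
      using R unfolding bounded_iff g_def by (metis imageI mem_cball_0)
    have "norm (\<alpha> k *\<^sub>R g k) \<le> \<alpha>_hi * G" for k
      using \<alpha>[of k] G[of k] by (simp add: mult_mono)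
    then show ?thesis by (auto simp: bounded_iff)
  qed
  \<comment> \<open>\<open>ln\<close> is increasing, so each log step has the signs of the
    step.\<close>
  moreover have "sgn ((x (Suc k) - x k) $ i) = sgn (p k $ i)" for k i
    using xpos[of k] xpos[of "Suc k"] by (auto simp: p_def log_vec_def pos_orthant_def sgn_if)
  ultimately have "bounded (range p)"
    by (intro bounded_of_sign_matched_orthogonal[of "{w. A *v w = 0}" "\<lambda>k. \<alpha> k *\<^sub>R g k" p
          "\<lambda>k. x (Suc k) - x k"])
      (use stat ker xD in auto)
  then obtain P where P: "\<And>k. norm (p k) \<le> P" by (auto simp: bounded_iff)
  note bounds = log_vec_step_bounds[OF xpos xpos P[unfolded p_def] R, folded p_def s_def]

  \<comment> \<open>\<open>1 / \<alpha>_hi - L\<close> is the descent left after the smoothness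
    error; \<open>exp (- P)\<close> converts the inner product of log step and step into
    \<open>(s k)^2\<close>.\<close>
  define c where "c = (1 / \<alpha>_hi - L) * exp (- P)"
  have gap: "1 / \<alpha>_hi - L > 0" using step_bounds L_pos by (simp add: field_simps)
  then have "c > 0" by (simp add: c_def)
  have decrease: "c * (s k)^2 \<le> f (x k) - f (x (Suc k))" for k
  proof -
    have "f (x (Suc k)) \<le> f (x k) + g k \<bullet> (x (Suc k) - x k) + L * (p k \<bullet> (x (Suc k) - x k))"
      unfolding p_def g_def using L_pos
      by (intro relatively_smooth_descent[OF rel_smooth _ xD xD xpos xpos grad]) simp
    \<comment> \<open>Stationarity tested on the step itself, a difference of feasible points and so
      in the kernel of \<open>A\<close>.\<close>
    moreover have "g k \<bullet> (x (Suc k) - x k) = - (1 / \<alpha> k * (p k \<bullet> (x (Suc k) - x k)))"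
      using stat[OF ker[OF xD xD], of k "Suc k" k] \<alpha>(2)[of k]
      by (simp add: inner_add_left field_simps)
    ultimately have "(1 / \<alpha> k - L) * (p k \<bullet> (x (Suc k) - x k)) \<le> f (x k) - f (x (Suc k))"
      by (simp add: algebra_simps)
    moreover have "1 / \<alpha>_hi \<le> 1 / \<alpha> k" using \<alpha>[of k] by (intro frac_le) auto
    then have "(1 / \<alpha>_hi - L) * (exp (- P) * (s k)^2) \<le> (1 / \<alpha> k - L) * (p k \<bullet> (x (Suc k) - x k))"
      using bounds(1)[of k] gap by (intro mult_mono) auto
    ultimately show ?thesis by (simp add: c_def)
  qed

  obtain z \<rho> where \<rho>: "strict_mono \<rho>" and xz: "(x \<circ> \<rho>) \<longlonglongrightarrow> z"
    using bounded_imp_convergent_subsequence[OF bounded_seq] by metis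
  have zD: "z \<in> D"
    by (rule closed_sequentially[OF _ _ xz]) (use xD closed_polyhedron_eq in \<open>auto simp: D_def\<close>)
  have anti: "decseq (\<lambda>k. f (x k))"
    using decrease \<open>c > 0\<close> by (intro decseq_SucI) (smt (verit) mult_nonneg_nonneg zero_le_power2)
  have f\<rho>: "(\<lambda>n. f (x (\<rho> n))) \<longlonglongrightarrow> f z"
    using isCont_tendsto_compose[OF f_cont xz] by simp
  \<comment> \<open>A nonincreasing sequence lies above its subsequential limit, so the gap
    \<open>f (x k) - f z\<close> is nonnegative; monotonicity also makes the whole sequence of
    values converge to \<open>f z\<close>.\<close>
  have fz: "f z \<le> f (x k)" for k
  proof (rule LIMSEQ_le_const2[OF f\<rho>], intro exI allI impI)
    fix n assume "k \<le> n"
    then have "k \<le> \<rho> n" using seq_suble[OF \<rho>, of n] by simp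
    then show "f (x (\<rho> n)) \<le> f (x k)" by (rule decseqD[OF anti])
  qed
  have "(\<lambda>k. f (x k)) \<longlonglongrightarrow> f z"
  proof -
    obtain l where l: "(\<lambda>k. f (x k)) \<longlonglongrightarrow> l" by (rule decseq_convergent[OF anti, of "f z"]) (use fz in auto)
    from LIMSEQ_subseq_LIMSEQ[OF this \<rho>] have "l = f z"
      using f\<rho> LIMSEQ_unique by (auto simp: o_def)
    then show ?thesis using l by simp
  qed
  then have r0: "(\<lambda>k. f (x k) - f z) \<longlonglongrightarrow> 0" by (rule LIM_zero)

  \<comment> \<open>Membership is what matters: each exhibited subgradient bounds the infimum
    \<open>dist_zero\<close> from above.\<close>
  have F_subdiff: "v \<in> orthant_subdiff F y"
    if "y \<in> D" "\<And>w. w \<in> D \<Longrightarrow> v \<bullet> (w - y) \<le> gradient f y \<bullet> (w - y)" for v y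
    unfolding orthant_subdiff_def F_def extend_orthant_eq[OF D_nonneg]
    using frechet_subdiff_constrained[OF that(1) grad that(2)] frechet_subset_limiting_subdiff by blast
  \<comment> \<open>\<open>gradient f z\<close> is itself a subgradient, which makes the SKL
    property available at \<open>z\<close>.\<close>
  have "orthant_subdiff F z \<noteq> {}" using F_subdiff[OF zD] by blast
  then obtain \<eta> U \<phi> \<phi>' where \<eta>: "0 < \<eta>" "open U" "z \<in> U" and des: "desingularizing \<eta> \<phi> \<phi>'"
    and KL: "\<And>y. y \<in> U \<inter> nonneg_orthant \<Longrightarrow> F z < F y \<and> F y < F z + \<eta> \<Longrightarrow>
      1 \<le> ereal (\<phi>' (real_of_ereal (F y - F z))) * dist_zero (diag_sqrt y ` orthant_subdiff F y)"
    using SKL unfolding SKL_function_def SKL_property_at_def by blast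
  have F: "F y = ereal (f y)" if "y \<in> D" for y using that by (simp add: F_def indicator_ereal_def)
  have KLx: "1 \<le> \<phi>' (f (x k) - f z) * (1 / \<alpha>_lo * s k)"
    if "x k \<in> U" "0 < f (x k) - f z" "ereal (f (x k) - f z) < \<eta>" for k
  proof -
    \<comment> \<open>By stationarity \<open>?v\<close> and \<open>g k\<close> agree on differences
      of feasible points, so \<open>?v\<close> is a subgradient; its weighted norm is
      \<open>s k / \<alpha> k\<close>, whence the constant \<open>1 / \<alpha>_lo\<close>.\<close>
    let ?v = "- (1 / \<alpha> k) *\<^sub>R p k"
    have \<phi>': "0 < \<phi>' (f (x k) - f z)" using des that by (simp add: desingularizing_def)
    have "?v \<bullet> (w - x k) = g k \<bullet> (w - x k)" if "w \<in> D" for w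
      using stat[OF ker[OF that xD], of k k] \<alpha>(2)[of k] by (simp add: inner_add_left field_simps)
    then have "?v \<in> orthant_subdiff F (x k)" using xD by (intro F_subdiff) (auto simp: g_def)
    then have "dist_zero (diag_sqrt (x k) ` orthant_subdiff F (x k)) \<le> ereal (norm (diag_sqrt (x k) ?v))"
      unfolding dist_zero_def by (intro INF_lower) auto
    moreover have "diag_sqrt (x k) ?v = - (1 / \<alpha> k) *\<^sub>R diag_sqrt (x k) (p k)"
      by (simp add: diag_sqrt_def vec_eq_iff)
    then have "norm (diag_sqrt (x k) ?v) = 1 / \<alpha> k * s k" using \<alpha>(2)[of k] by (simp add: s_def)
    moreover have "1 / \<alpha> k * s k \<le> 1 / \<alpha>_lo * s k"
      using \<alpha>[of k] step_bounds by (intro mult_right_mono) (auto simp: s_def frac_le)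
    ultimately have d: "dist_zero (diag_sqrt (x k) ` orthant_subdiff F (x k)) \<le> ereal (1 / \<alpha>_lo * s k)"
      by (metis ereal_less_eq(3) order_trans)
    have "F (x k) < F z + \<eta>"
      using that(3) by (cases \<eta>) (auto simp: F xD zD)
    then have "1 \<le> ereal (\<phi>' (f (x k) - f z)) * dist_zero (diag_sqrt (x k) ` orthant_subdiff F (x k))"
      using KL[of "x k"] that subsetD[OF D_nonneg xD[of k]] by (auto simp: F xD zD)
    also have "\<dots> \<le> ereal (\<phi>' (f (x k) - f z)) * ereal (1 / \<alpha>_lo * s k)"
      using \<phi>' by (intro ereal_mult_left_mono d) auto
    finally show ?thesis by (simp add: one_ereal_def)
  qed
  \<comment> \<open>The constants are \<open>B = 1 / \<alpha>_lo\<close> and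
    \<open>C = exp P * sqrt R\<close>.\<close>
  have "x \<longlonglongrightarrow> z"
  proof (rule KL_convergence[OF des \<eta> _ r0 _ _ \<open>c > 0\<close> _ _ bounds(2) KLx \<rho> xz])
    show "0 \<le> exp P * sqrt R" using order_trans[OF norm_ge_zero R] by simp
  qed (use fz decrease step_bounds in \<open>auto simp: s_def\<close>)
  \<comment> \<open>For the subgradient 0 the criterion becomes the variational inequality for
    \<open>gradient f z\<close> over \<open>D\<close>.\<close>
  moreover have "0 \<in> frechet_subdiff F z"
    unfolding F_def
  proof (rule frechet_subdiff_constrained[OF zD grad])
    fix y assume "y \<in> D"
    have "0 \<le> gradient f z \<bullet> (y - z)"
    proof (rule variational_inequality_limit[OF xpos \<open>x \<longlonglongrightarrow> z\<close> _ step_bounds(1) \<alpha>(1)])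
      show "g \<longlonglongrightarrow> gradient f z"
        unfolding g_def by (rule isCont_tendsto_compose[OF grad_cont \<open>x \<longlonglongrightarrow> z\<close>])
    qed (use stat[OF ker[OF \<open>y \<in> D\<close> zD]] \<open>y \<in> D\<close> D_nonneg in \<open>auto simp: p_def\<close>)
    then show "0 \<bullet> (y - z) \<le> gradient f z \<bullet> (y - z)" by simp
  qed
  ultimately show ?thesis
    using frechet_subset_limiting_subdiff unfolding critical_point_def by blast
qed

end
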